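(* Let $K$ be a field, let $n_1<n_2<n_3<n_4$ be positive integers with $\gcd(n_1,n_2,n_3,n_4)=1$, and let $C$ be the monomial curve $x_i=t^{n_i}$ ($1\le i\le 4$) in $\mathbb{A}^4(K)$. Assume that $C$ is Gorenstein and not a complete intersection, that $C$ has Cohen-Macaulay tangent cone at the origin, and that $I(C)$ is minimally generated by $$f_1=x_1^{a_1}-x_2^{a_{12}}x_3^{a_{13}},\quad f_2=x_2^{a_2}-x_1^{a_{21}}x_4^{a_{24}},\quad f_3=x_3^{a_3}-x_2^{a_{32}}x_4^{a_{34}},$$ $$f_4=x_4^{a_4}-x_1^{a_{41}}x_3^{a_{43}},\quad f_5=x_1^{a_{41}}x_2^{a_{32}}-x_3^{a_{13}}x_4^{a_{24}},$$ where $a_i>1$ and $0<a_{ij}<a_j$ for all the exponents appearing. Suppose that $a_3>a_{32}+a_{34}$ and $a_{24}\le a_{34}$. Let $p_2=x_2^{a_2}$ if $a_2<a_{21}+a_{24}$ and $p_2=x_2^{a_2}-x_1^{a_{21}}x_4^{a_{24}}$ if $a_2=a_{21}+a_{24}$. (i) Suppose $a_{32}<a_{12}$. If $a_2\le a_{21}+a_{24}$ and $a_3+a_{13}\le a_{41}+2a_{32}+a_{34}-a_{24}$, then $I(C)_*$ is minimally generated by the six polynomials $$G_*=\{x_2^{a_{12}}x_3^{a_{13}},\ p_2,\ x_2^{a_{32}}x_4^{a_{34}},\ x_4^{a_4},\ x_3^{a_{13}}x_4^{a_{24}},\ p_6\},$$ where $p_6=x_3^{a_3+a_{13}}$ if $a_3+a_{13}<a_{41}+2a_{32}+a_{34}-a_{24}$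 and $p_6=x_3^{a_3+a_{13}}-x_1^{a_{41}}x_2^{2a_{32}}x_4^{a_{34}-a_{24}}$ if $a_3+a_{13}=a_{41}+2a_{32}+a_{34}-a_{24}$. (ii) Suppose $a_{12}\le a_{32}$. If $a_2\le a_{21}+a_{24}$ and $a_3+a_{13}\le a_1+a_{32}-a_{12}+a_{34}$, then $I(C)_*$ is minimally generated by the six polynomials $$G_*=\{x_2^{a_{12}}x_3^{a_{13}},\ p_2,\ x_2^{a_{32}}x_4^{a_{34}},\ x_4^{a_4},\ x_3^{a_{13}}x_4^{a_{24}},\ p_6\},$$ where $p_6=x_3^{a_3+a_{13}}$ if $a_3+a_{13}<a_1+a_{32}-a_{12}+a_{34}$ and $p_6=x_3^{a_3+a_{13}}-x_1^{a_1}x_2^{a_{32}-a_{12}}x_4^{a_{34}}$ if $a_3+a_{13}=a_1+a_{32}-a_{12}+a_{34}$.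
   Context: $I(C)$ is the kernel of the $K$-algebra homomorphism $\phi:K[x_1,\ldots,x_4]\to K[t]$, $\phi(x_i)=t^{n_i}$. $C$ is Gorenstein when the numerical semigroup generated by $n_1,\ldots,n_4$ is symmetric, and it is not a complete intersection when $I(C)$ cannot be generated by three elements. For $0\ne f\in I(C)$, $f_*$ denotes the homogeneous summand of $f$ of least (standard) degree, and $I(C)_*$ is the ideal of $K[x_1,\ldots,x_4]$ generated by all $f_*$, $f\in I(C)$; it is the defining ideal of the tangent cone of $C$ at the origin. $C$ has Cohen-Macaulay tangent cone at the origin if $K[x_1,\ldots,x_4]/I(C)_*$ is Cohen-Macaulay. In the described situation the exponents satisfy (Bresinsky) $a_1=a_{21}+a_{41}$, $a_2=a_{12}+a_{32}$, $a_3=a_{13}+a_{43}$, $a_4=a_{24}+a_{34}$. *)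

theory Defs
  imports
    "HOL-Library.Poly_Mapping"
    "HOL-Library.Extended_Nat"
    "HOL-Computational_Algebra.Polynomial"
    "HOL-Algebra.QuotRing"
    "HOL-Algebra.Ring_Divisibility"
    "HOL-Algebra.Algebraic_Closure_Type"
begin

section \<open>The polynomial ring in four variables\<close>

datatype idx = V1 | V2 | V3 | V4

lemma UNIV_idx: "(UNIV :: idx set) = {V1, V2, V3, V4}"
  using idx.exhaust by auto

instance idx :: finite
  by standard (simp add: UNIV_idx)

text \<open>A polynomial is its finitely supported coefficient function on exponent vectors.\<close>

type_synonym 'k mpoly4 = "(idx \<Rightarrow>\<^sub>0 nat) \<Rightarrow>\<^sub>0 'k"

abbreviation mpoly4_ring :: "'k::field mpoly4 ring" where
  "mpoly4_ring \<equiv> ring_of_type_algebra"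

definition mvar :: "idx \<Rightarrow> 'k::field mpoly4" where
  "mvar i = Poly_Mapping.single (Poly_Mapping.single i 1) 1"

abbreviation X1 :: "'k::field mpoly4" where "X1 \<equiv> mvar V1"
abbreviation X2 :: "'k::field mpoly4" where "X2 \<equiv> mvar V2"
abbreviation X3 :: "'k::field mpoly4" where "X3 \<equiv> mvar V3"
abbreviation X4 :: "'k::field mpoly4" where "X4 \<equiv> mvar V4"

definition mdegree :: "(idx \<Rightarrow>\<^sub>0 nat) \<Rightarrow> nat" where
  "mdegree m = (\<Sum>i\<in>UNIV. Poly_Mapping.lookup m i)"

definition hom_component :: "nat \<Rightarrow> 'k::field mpoly4 \<Rightarrow> 'k mpoly4" where
  "hom_component d f =
     (\<Sum>m | m \<in> Poly_Mapping.keys f \<and> mdegree m = d.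
        Poly_Mapping.single m (Poly_Mapping.lookup f m))"

text \<open>Only meaningful for nonzero \<open>f\<close>.\<close>

definition initial_form :: "'k::field mpoly4 \<Rightarrow> 'k mpoly4" where
  "initial_form f = hom_component (Min (mdegree ` Poly_Mapping.keys f)) f"

definition initial_ideal :: "'k::field mpoly4 set \<Rightarrow> 'k mpoly4 set" where
  "initial_ideal I = Idl\<^bsub>mpoly4_ring\<^esub> {initial_form f | f. f \<in> I \<and> f \<noteq> 0}"

text \<open>Minimality is with respect to inclusion. Generators are given as a list, so that
  the number of generators is part of the claim.\<close>

definition minimally_generated_by :: "'k::field mpoly4 set \<Rightarrow> 'k mpoly4 list \<Rightarrow> bool" where
  "minimally_generated_by I fs \<longleftrightarrow>
     distinct fs \<and> Idl\<^bsub>mpoly4_ring\<^esub> (set fs) = I \<and>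
     (\<forall>T. T \<subset> set fs \<longrightarrow> Idl\<^bsub>mpoly4_ring\<^esub> T \<noteq> I)"


section \<open>Monomial curves\<close>

definition curve_map :: "(idx \<Rightarrow> nat) \<Rightarrow> 'k::field mpoly4 \<Rightarrow> 'k poly" where
  "curve_map n f =
     (\<Sum>m\<in>Poly_Mapping.keys f.
        smult (Poly_Mapping.lookup f m)
          (\<Prod>i\<in>UNIV. (Polynomial.monom 1 (n i)) ^ Poly_Mapping.lookup m i))"

definition curve_ideal :: "(idx \<Rightarrow> nat) \<Rightarrow> 'k::field mpoly4 set" where
  "curve_ideal n = {f. curve_map n f = 0}"

definition num_semigroup :: "(idx \<Rightarrow> nat) \<Rightarrow> nat set" where
  "num_semigroup n = {\<Sum>i\<in>UNIV. c i * n i | c. True}"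

text \<open>The Frobenius number of a numerical semigroup is the largest integer outside it;
  it is an integer since it equals \<open>-1\<close> for the semigroup of all natural numbers.\<close>

definition frobenius_number :: "nat set \<Rightarrow> int" where
  "frobenius_number S = (GREATEST z::int. z \<notin> int ` S)"

definition symmetric_semigroup :: "nat set \<Rightarrow> bool" where
  "symmetric_semigroup S \<longleftrightarrow>
     (\<forall>z::int. z \<in> int ` S \<longleftrightarrow> frobenius_number S - z \<notin> int ` S)"

definition curve_gorenstein :: "(idx \<Rightarrow> nat) \<Rightarrow> bool" where
  "curve_gorenstein n \<longleftrightarrow> symmetric_semigroup (num_semigroup n)"

definition three_generated :: "'k::field mpoly4 set \<Rightarrow> bool" where
  "three_generated I \<longleftrightarrow> (\<exists>g1 g2 g3. I = Idl\<^bsub>mpoly4_ring\<^esub> {g1, g2, g3})"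


section \<open>Cohen-Macaulay rings\<close>

definition regular_sequence :: "('a, 'b) ring_scheme \<Rightarrow> 'a list \<Rightarrow> bool" where
  "regular_sequence R xs \<longleftrightarrow>
     set xs \<subseteq> carrier R \<and>
     (\<forall>i < length xs. \<forall>r \<in> carrier R.
        xs ! i \<otimes>\<^bsub>R\<^esub> r \<in> Idl\<^bsub>R\<^esub> (set (take i xs)) \<longrightarrow> r \<in> Idl\<^bsub>R\<^esub> (set (take i xs))) \<and>
     Idl\<^bsub>R\<^esub> (set xs) \<noteq> carrier R"

definition ideal_depth :: "('a, 'b) ring_scheme \<Rightarrow> 'a set \<Rightarrow> enat" where
  "ideal_depth R I = Sup {enat (length xs) | xs. regular_sequence R xs \<and> set xs \<subseteq> I}"

text \<open>The codimension (height) of a prime ideal \<open>P\<close>: the supremum of the lengths \<open>k\<close> of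
  chains \<open>Q 0 \<subset> \<dots> \<subset> Q k = P\<close> of prime ideals.\<close>

definition prime_codim :: "('a, 'b) ring_scheme \<Rightarrow> 'a set \<Rightarrow> enat" where
  "prime_codim R P =
     Sup {enat k | k. \<exists>Q :: nat \<Rightarrow> 'a set.
        (\<forall>i \<le> k. primeideal (Q i) R) \<and> (\<forall>i < k. Q i \<subset> Q (Suc i)) \<and> Q k = P}"

text \<open>Eisenbud's definition (Commutative Algebra, Section 18.2): a Noetherian ring in which
  depth and codimension of every maximal ideal agree. The depth of \<open>P\<close> on \<open>R\<close> and the
  codimension of \<open>P\<close> are the depth and the dimension of the localization at \<open>P\<close>, so
  this says that all localizations at maximal ideals are Cohen-Macaulay.\<close>

definition cohen_macaulay :: "('a, 'b) ring_scheme \<Rightarrow> bool" where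
  "cohen_macaulay R \<longleftrightarrow>
     cring R \<and> noetherian_ring R \<and>
     (\<forall>P. maximalideal P R \<longrightarrow> ideal_depth R P = prime_codim R P)"

end

theory Submission
  imports Defs
begin

text \<open>A power of \<open>x_i\<close> with exponent below \<open>a_i\<close> is divisible by no monomial of a
  generator, hence is the only monomial of its weight; together with the weight equations of
  the generators this forces Bresinsky's relations between the exponents.
  Adding \<open>f6\<close>, the S-polynomial of \<open>f3\<close> and \<open>f5\<close> (case (i)) or of
  \<open>f3\<close> and \<open>f1\<close> (case (ii)), gives six binomials, each read as a rule on exponent
  vectors that does not decrease the degree. All critical pairs of these rules join, so a monomial
  has a unique normal form, and normal forms of the same weight coincide. Replacing every monomial
  of the lowest degree part of some \<open>f \<in> I\<close> by its normal form then shows that this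
  part lies in the ideal of the six leading forms. Their leading monomials do not involve
  \<open>x1\<close> and form an antichain under divisibility, whence minimality.\<close>

section \<open>Ideals of the polynomial ring\<close>

abbreviation pmon :: "(idx \<Rightarrow>\<^sub>0 nat) \<Rightarrow> 'k::field mpoly4" where
  "pmon u \<equiv> Poly_Mapping.single u 1"

abbreviation idl :: "'k::field mpoly4 set \<Rightarrow> 'k mpoly4 set" where
  "idl G \<equiv> Idl\<^bsub>mpoly4_ring\<^esub> G"

lemma ring_mpoly4: "ring (mpoly4_ring :: 'k::field mpoly4 ring)"
  by (rule ring_from_type_algebra)

lemma mpoly4_ring_sel [simp]:
  "carrier (mpoly4_ring :: 'k::field mpoly4 ring) = UNIV"
  "(x :: 'k mpoly4) \<otimes>\<^bsub>mpoly4_ring\<^esub> y = x * y"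
  "x \<oplus>\<^bsub>mpoly4_ring\<^esub> y = x + y"
  "\<zero>\<^bsub>mpoly4_ring\<^esub> = (0 :: 'k mpoly4)"
  by (simp_all add: ring_of_type_algebra_def)

lemma ideal_mpoly4I:
  fixes J :: "'k::field mpoly4 set"
  assumes "0 \<in> J" "\<And>f g. f \<in> J \<Longrightarrow> g \<in> J \<Longrightarrow> f + g \<in> J" "\<And>p f. f \<in> J \<Longrightarrow> p * f \<in> J"
  shows "ideal J mpoly4_ring"
proof (rule idealI[OF ring_mpoly4])
  have "- f \<in> J" if "f \<in> J" for f
    using assms(3)[OF that, of "-1"] by simp
  moreover have "\<ominus>\<^bsub>mpoly4_ring\<^esub> f = - f" for f :: "'k mpoly4"
  proof -
    interpret ring "mpoly4_ring :: 'k mpoly4 ring" by (rule ring_mpoly4)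
    show ?thesis by (rule minus_equality) auto
  qed
  ultimately show "subgroup J (add_monoid mpoly4_ring)"
    using assms abelian_group.a_group[OF ring.is_abelian_group[OF ring_mpoly4[where 'k='k]]]
    by (intro group.subgroupI) (auto simp: a_inv_def)
next
  fix f p assume "f \<in> J"
  from assms(3)[OF this, of p]
  show "p \<otimes>\<^bsub>mpoly4_ring\<^esub> f \<in> J" "f \<otimes>\<^bsub>mpoly4_ring\<^esub> p \<in> J"
    by (simp_all add: mult.commute)
qed

lemma idl_incl: "g \<in> G \<Longrightarrow> g \<in> idl G"
  using ring.genideal_self[OF ring_mpoly4, of G] by auto

lemma idl_ideal: "ideal (idl G) (mpoly4_ring :: 'k::field mpoly4 ring)"
  by (rule ring.genideal_ideal[OF ring_mpoly4]) simp

lemma idl_zero: "0 \<in> idl G"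
  using additive_subgroup.zero_closed[OF ideal.axioms(1)[OF idl_ideal]] by simp

lemma idl_add: "f \<in> idl G \<Longrightarrow> g \<in> idl G \<Longrightarrow> f + g \<in> idl G"
  using additive_subgroup.a_closed[OF ideal.axioms(1)[OF idl_ideal]] by simp

lemma idl_mult: "f \<in> idl G \<Longrightarrow> p * f \<in> idl G"
  using ideal.I_l_closed[OF idl_ideal] by simp

lemma idl_uminus: "f \<in> idl G \<Longrightarrow> - f \<in> idl G"
  using idl_mult[of f G "-1"] by simp

lemma idl_sum: "(\<And>i. i \<in> S \<Longrightarrow> h i \<in> idl G) \<Longrightarrow> sum h S \<in> idl G"
  by (induction S rule: infinite_finite_induct) (auto simp: idl_zero idl_add)

lemma idl_minimal:
  assumes "\<And>g. g \<in> G \<Longrightarrow> g \<in> idl H"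
  shows "idl G \<subseteq> idl H"
  by (rule ring.genideal_minimal[OF ring_mpoly4 idl_ideal]) (use assms in auto)

section \<open>Linear functionals that sum coefficients\<close>

lemma poly_mapping_sum_singles:
  "f = (\<Sum>m\<in>Poly_Mapping.keys f. Poly_Mapping.single m (Poly_Mapping.lookup f m))"
  by (rule poly_mapping_eqI) (simp add: lookup_sum lookup_single when_def in_keys_iff)

text \<open>Three choices of \<open>A\<close> matter: a single monomial gives a coefficient, a
  weight class gives a coefficient of the image under \<open>curve_map\<close>, and the monomials
  rewriting to a fixed normal one separate normal forms.\<close>

definition coeff_sum :: "(idx \<Rightarrow>\<^sub>0 nat) set \<Rightarrow> 'k::field mpoly4 \<Rightarrow> 'k" where
  "coeff_sum A f = (\<Sum>m\<in>Poly_Mapping.keys f \<inter> A. Poly_Mapping.lookup f m)"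

lemma coeff_sum_superset:
  assumes "finite S" "Poly_Mapping.keys f \<subseteq> S"
  shows "coeff_sum A f = (\<Sum>m\<in>S \<inter> A. Poly_Mapping.lookup f m)"
  unfolding coeff_sum_def
  by (rule sum.mono_neutral_left) (use assms in \<open>auto simp: in_keys_iff\<close>)

lemma coeff_sum_zero [simp]: "coeff_sum A 0 = 0"
  by (simp add: coeff_sum_def)

lemma coeff_sum_add: "coeff_sum A (f + g) = coeff_sum A f + coeff_sum A g"
proof -
  let ?S = "Poly_Mapping.keys f \<union> Poly_Mapping.keys g"
  have "Poly_Mapping.keys (f + g) \<subseteq> ?S" by (rule keys_add)
  then show ?thesis
    by (simp add: coeff_sum_superset[of ?S] lookup_add sum.distrib)
qed

lemma coeff_sum_single [simp]:
  "coeff_sum A (Poly_Mapping.single u c) = (if u \<in> A then c else 0)"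
  by (subst coeff_sum_superset[of "{u}"]) auto

lemma coeff_sum_diff: "coeff_sum A (f - g) = coeff_sum A f - coeff_sum A g"
  using coeff_sum_add[of A "f - g" g] by (simp add: algebra_simps)

lemma coeff_sum_sum: "coeff_sum A (sum h S) = (\<Sum>i\<in>S. coeff_sum A (h i))"
  by (induction S rule: infinite_finite_induct) (auto simp: coeff_sum_add)

lemma coeff_sum_singleton: "coeff_sum {m} f = Poly_Mapping.lookup f m"
  by (cases "m \<in> Poly_Mapping.keys f") (auto simp: coeff_sum_def in_keys_iff)

lemma coeff_sum_single_mult:
  "coeff_sum A (Poly_Mapping.single u c * f) =
     (\<Sum>m\<in>Poly_Mapping.keys f. if u + m \<in> A then c * Poly_Mapping.lookup f m else 0)"
  by (subst poly_mapping_sum_singles[of f])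
    (simp add: sum_distrib_left mult_single coeff_sum_sum)

text \<open>The kernel of \<open>coeff_sum A\<close> is in general not an ideal, but the polynomials
  all of whose monomial multiples lie in it form one. Hence testing monomial multiples of the
  generators suffices.\<close>

lemma coeff_sum_idl:
  fixes G :: "'k::field mpoly4 set"
  assumes "\<And>g u. g \<in> G \<Longrightarrow> coeff_sum A (pmon u * g) = 0" and "f \<in> idl G"
  shows "coeff_sum A f = 0"
proof -
  let ?J = "{f :: 'k mpoly4. \<forall>u. coeff_sum A (pmon u * f) = 0}"
  have "ideal ?J mpoly4_ring"
  proof (rule ideal_mpoly4I)
    fix p f :: "'k mpoly4" assume f: "f \<in> ?J"
    have *: "coeff_sum A (Poly_Mapping.single v c * f) = 0" for v c
    proof -
      have "coeff_sum A (Poly_Mapping.single v c * f) = c * coeff_sum A (pmon v * f)"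
        by (simp add: coeff_sum_single_mult sum_distrib_left if_distrib cong: if_cong)
      then show ?thesis using f by simp
    qed
    show "p * f \<in> ?J"
    proof (rule CollectI, rule allI)
      fix u
      have "pmon u * (p * f) =
          (\<Sum>v\<in>Poly_Mapping.keys p. Poly_Mapping.single (u + v) (Poly_Mapping.lookup p v) * f)"
        by (subst poly_mapping_sum_singles[of p])
          (simp add: sum_distrib_left sum_distrib_right mult_single flip: mult.assoc)
      then show "coeff_sum A (pmon u * (p * f)) = 0"
        by (simp add: coeff_sum_sum *)
    qed
  qed (auto simp: coeff_sum_add distrib_left)
  moreover have "G \<subseteq> ?J" using assms(1) by auto
  ultimately have "f \<in> ?J"
    using ring.genideal_minimal[OF ring_mpoly4] assms(2) by blast
  then have "coeff_sum A (pmon 0 * f) = 0" by blast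
  then show ?thesis by simp
qed

section \<open>Divisibility of monomials and minimal generation\<close>

abbreviation mdivides :: "(idx \<Rightarrow>\<^sub>0 nat) \<Rightarrow> (idx \<Rightarrow>\<^sub>0 nat) \<Rightarrow> bool" where
  "mdivides u v \<equiv> (\<forall>i. Poly_Mapping.lookup u i \<le> Poly_Mapping.lookup v i)"

text \<open>A monomial multiple of a generator contains \<open>m\<close> only if some monomial of
  that generator divides \<open>m\<close>.\<close>

lemma lookup_idl_eq_0:
  assumes "\<And>g v. g \<in> G \<Longrightarrow> v \<in> Poly_Mapping.keys g \<Longrightarrow> \<not> mdivides v m" and "f \<in> idl G"
  shows "Poly_Mapping.lookup f m = 0"
proof -
  have "coeff_sum {m} f = 0"
    using assms(2)
  proof (rule coeff_sum_idl[rotated])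
    fix g u assume g: "g \<in> G"
    have "u + v \<noteq> m" if "v \<in> Poly_Mapping.keys g" for v
      using assms(1)[OF g that] by (auto simp: lookup_add)
    then show "coeff_sum {m} (pmon u * g) = 0" by (simp add: coeff_sum_single_mult)
  qed
  then show ?thesis by (simp add: coeff_sum_singleton)
qed

text \<open>The monomial \<open>m\<close> certifies that its generator lies outside the ideal of the
  others: every monomial occurring in that ideal is a multiple of a monomial of one of them.\<close>

lemma minimally_generated_byI:
  assumes J: "idl (set gs) = J"
    and lead: "\<And>i. i < length gs \<Longrightarrow> \<exists>m. Poly_Mapping.lookup (gs ! i) m \<noteq> 0 \<and>
      (\<forall>j<length gs. j \<noteq> i \<longrightarrow> (\<forall>v\<in>Poly_Mapping.keys (gs ! j). \<not> mdivides v m))"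
  shows "minimally_generated_by J gs"
  unfolding minimally_generated_by_def
proof (intro conjI allI impI J notI)
  show "distinct gs"
    unfolding distinct_conv_nth
  proof (intro allI impI notI)
    fix i j assume ij: "i < length gs" "j < length gs" "i \<noteq> j" "gs ! i = gs ! j"
    obtain m where "Poly_Mapping.lookup (gs ! i) m \<noteq> 0"
      "\<forall>v\<in>Poly_Mapping.keys (gs ! j). \<not> mdivides v m"
      using lead[OF ij(1)] ij(2,3) by blast
    then show False using ij(4) by (auto simp: in_keys_iff)
  qed
next
  fix T assume T: "T \<subset> set gs" "idl T = J"
  then obtain g where g: "g \<in> set gs" "g \<notin> T" by blast
  then obtain i where i: "i < length gs" "gs ! i = g" by (auto simp: in_set_conv_nth)
  obtain m where m: "Poly_Mapping.lookup g m \<noteq> 0"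
    "\<And>j v. j < length gs \<Longrightarrow> j \<noteq> i \<Longrightarrow> v \<in> Poly_Mapping.keys (gs ! j) \<Longrightarrow> \<not> mdivides v m"
    using lead[OF i(1)] i(2) by blast
  have "g \<in> idl T" unfolding T(2) J[symmetric] using g(1) by (rule idl_incl)
  then have "Poly_Mapping.lookup g m = 0"
  proof (rule lookup_idl_eq_0[rotated])
    fix h v assume h: "h \<in> T" "v \<in> Poly_Mapping.keys h"
    have "h \<in> set gs" using T(1) h(1) by blast
    then obtain j where j: "j < length gs" "gs ! j = h" by (auto simp: in_set_conv_nth)
    then show "\<not> mdivides v m" using m(2)[of j v] h g(2) i by blast
  qed
  then show False using m(1) by simp
qed

section \<open>The curve ideal described by weights\<close>

definition weight :: "(idx \<Rightarrow> nat) \<Rightarrow> (idx \<Rightarrow>\<^sub>0 nat) \<Rightarrow> nat" where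
  "weight n m = (\<Sum>i\<in>UNIV. Poly_Mapping.lookup m i * n i)"

lemma weight_add: "weight n (u + v) = weight n u + weight n v"
  by (simp add: weight_def lookup_add distrib_right sum.distrib)

lemma mdegree_add: "mdegree (u + v) = mdegree u + mdegree v"
  by (simp add: mdegree_def lookup_add sum.distrib)

lemma mdegree_le_weight: "(\<And>i. 0 < n i) \<Longrightarrow> mdegree u \<le> weight n u"
  unfolding mdegree_def weight_def by (rule sum_mono) (simp add: Suc_leI)

lemma coeff_curve_map: "coeff (curve_map n f) k = coeff_sum {m. weight n m = k} f"
proof -
  have "(\<Prod>i\<in>UNIV. (Polynomial.monom (1::'a) (n i)) ^ Poly_Mapping.lookup m i)
      = Polynomial.monom 1 (weight n m)" for m
    by (simp add: UNIV_idx weight_def monom_power mult_monom algebra_simps)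
  then have "coeff (curve_map n f) k = 
      (\<Sum>m\<in>Poly_Mapping.keys f. if weight n m = k then Poly_Mapping.lookup f m else 0)"
    by (auto simp: curve_map_def coeff_sum smult_monom intro!: sum.cong)
  also have "\<dots> = coeff_sum {m. weight n m = k} f"
    by (simp add: coeff_sum_def sum.If_cases)
  finally show ?thesis .
qed

lemma mem_curve_ideal_iff: "f \<in> curve_ideal n \<longleftrightarrow> (\<forall>k. coeff_sum {m. weight n m = k} f = 0)"
  by (simp add: curve_ideal_def poly_eq_iff coeff_curve_map)

lemma binomial_mem_curve_ideal_iff:
  "pmon u - pmon v \<in> curve_ideal n \<longleftrightarrow> weight n u = weight n v"
  by (auto simp: mem_curve_ideal_iff coeff_sum_diff)

section \<open>Rewriting exponent vectors\<close>

definition rewrites_to :: "((idx \<Rightarrow>\<^sub>0 nat) \<times> (idx \<Rightarrow>\<^sub>0 nat)) set \<Rightarrow> (idx \<Rightarrow>\<^sub>0 nat) \<Rightarrow> (idx \<Rightarrow>\<^sub>0 nat) \<Rightarrow> bool" where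
  "rewrites_to R u v \<longleftrightarrow> (\<exists>l t w. (l, t) \<in> R \<and> u = w + l \<and> v = w + t)"

definition joinable :: "((idx \<Rightarrow>\<^sub>0 nat) \<times> (idx \<Rightarrow>\<^sub>0 nat)) set \<Rightarrow> (idx \<Rightarrow>\<^sub>0 nat) \<Rightarrow> (idx \<Rightarrow>\<^sub>0 nat) \<Rightarrow> bool" where
  "joinable R u v \<longleftrightarrow> (\<exists>z. (rewrites_to R)\<^sup>*\<^sup>* u z \<and> (rewrites_to R)\<^sup>*\<^sup>* v z)"

lemma rewrites_add:
  assumes "rewrites_to R u v"
  shows "rewrites_to R (c + u) (c + v)"
proof -
  obtain l t w where "(l, t) \<in> R" "u = w + l" "v = w + t"
    using assms unfolding rewrites_to_def by blast
  then have "(l, t) \<in> R \<and> c + u = (c + w) + l \<and> c + v = (c + w) + t"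
    by (simp add: add.assoc)
  then show ?thesis unfolding rewrites_to_def by blast
qed

lemma rewrites_star_add:
  assumes "(rewrites_to R)\<^sup>*\<^sup>* u v"
  shows "(rewrites_to R)\<^sup>*\<^sup>* (c + u) (c + v)"
  using assms by induction (auto intro: rewrites_add rtranclp.rtrancl_into_rtrancl)

text \<open>A common multiple of \<open>l\<close> and \<open>l'\<close> is \<open>c\<close> times
  their least common multiple, in which the truncated differences are the cofactors. Thus every
  overlap of two rules is a shift of a single critical pair.\<close>

lemma add_eq_add_exponent:
  fixes w l w' l' :: "idx \<Rightarrow>\<^sub>0 nat"
  assumes "w + l = w' + l'"
  shows "\<exists>c. w = c + (l' - l) \<and> w' = c + (l - l')"
proof -
  have eq: "Poly_Mapping.lookup w i + Poly_Mapping.lookup l i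
      = Poly_Mapping.lookup w' i + Poly_Mapping.lookup l' i" for i
    using assms by (metis lookup_add)
  have "w = (w - (l' - l)) + (l' - l)"
  proof (rule poly_mapping_eqI)
    fix i show "Poly_Mapping.lookup w i = Poly_Mapping.lookup (w - (l' - l) + (l' - l)) i"
      using eq[of i] by (simp add: lookup_add lookup_minus)
  qed
  moreover have "w' = (w - (l' - l)) + (l - l')"
  proof (rule poly_mapping_eqI)
    fix i show "Poly_Mapping.lookup w' i = Poly_Mapping.lookup (w - (l' - l) + (l - l')) i"
      using eq[of i] by (simp add: lookup_add lookup_minus)
  qed
  ultimately show ?thesis by blast
qed

text \<open>For a rule that does not decrease the degree this is the initial form of its binomial;
  \<open>p2\<close> and \<open>p6\<close> make the same case distinction.\<close>

definition lead_form :: "(idx \<Rightarrow>\<^sub>0 nat) \<times> (idx \<Rightarrow>\<^sub>0 nat) \<Rightarrow> 'k::field mpoly4" where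
  "lead_form = (\<lambda>(l, t). if mdegree l < mdegree t then pmon l else pmon l - pmon t)"

lemma initial_form_binomial:
  fixes u v :: "idx \<Rightarrow>\<^sub>0 nat"
  assumes "u \<noteq> v" "mdegree u \<le> mdegree v"
  shows "initial_form (pmon u - pmon v :: 'k::field mpoly4)
     = (if mdegree u < mdegree v then pmon u else pmon u - pmon v)"
proof -
  have k: "Poly_Mapping.keys (pmon u - pmon v :: 'k mpoly4) = {u, v}"
    using assms(1) by (auto simp: in_keys_iff lookup_minus lookup_single when_def split: if_splits)
  have l: "Poly_Mapping.lookup (pmon u - pmon v :: 'k mpoly4) u = 1"
    "Poly_Mapping.lookup (pmon u - pmon v :: 'k mpoly4) v = - 1"
    using assms(1) by (auto simp: lookup_minus lookup_single)
  have m: "Min (mdegree ` {u, v}) = mdegree u" using assms(2) by simp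
  have "initial_form (pmon u - pmon v :: 'k mpoly4) = 
      (\<Sum>m | m \<in> {u, v} \<and> mdegree m = mdegree u.
        Poly_Mapping.single m (Poly_Mapping.lookup (pmon u - pmon v :: 'k mpoly4) m))"
    by (simp only: initial_form_def hom_component_def k m)
  also have "{m. m \<in> {u, v} \<and> mdegree m = mdegree u} = (if mdegree u < mdegree v then {u} else {u, v})"
    using assms(2) by auto
  finally show ?thesis using assms(1) by (auto simp: l single_uminus)
qed

text \<open>Lexicographic comparison of pairs, read as two-digit numbers in base
  \<open>c + 1\<close>.\<close>

lemma mult_Suc_add_less:
  fixes a b c x y :: nat
  assumes "b < a" "y \<le> c"
  shows "b * Suc c + y < a * Suc c + x"
proof -
  have "Suc b * Suc c \<le> a * Suc c" by (rule mult_le_mono1) (use assms in simp)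
  then show ?thesis using assms(2) by simp
qed

text \<open>Since lowest degree forms are sought, rules lead towards higher degree, and within one
  degree towards higher powers of \<open>x1\<close>. Both sides in \<open>critical_pairs\<close> are
  outcomes of rewriting the least common multiple of \<open>l\<close> and \<open>l'\<close>.\<close>

locale monomial_curve_rewriting =
  fixes n :: "idx \<Rightarrow> nat" and R :: "((idx \<Rightarrow>\<^sub>0 nat) \<times> (idx \<Rightarrow>\<^sub>0 nat)) set"
  assumes n_pos: "\<And>i. 0 < n i"
    and homogeneous: "\<And>l t. (l, t) \<in> R \<Longrightarrow> weight n l = weight n t"
    and oriented: "\<And>l t. (l, t) \<in> R \<Longrightarrow> mdegree l < mdegree t \<or>
      mdegree l = mdegree t \<and> Poly_Mapping.lookup l V1 < Poly_Mapping.lookup t V1"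
    and critical_pairs: "\<And>l t l' t'. (l, t) \<in> R \<Longrightarrow> (l', t') \<in> R \<Longrightarrow>
      joinable R ((l' - l) + t) ((l - l') + t')"
begin

definition normal :: "(idx \<Rightarrow>\<^sub>0 nat) \<Rightarrow> bool" where
  "normal u \<longleftrightarrow> (\<nexists>v. rewrites_to R u v)"

lemma rewrites_weight: "rewrites_to R u v \<Longrightarrow> weight n u = weight n v"
  by (auto simp: rewrites_to_def weight_add homogeneous)

lemma rewrites_oriented:
  "rewrites_to R u v \<Longrightarrow> mdegree u < mdegree v \<or>
     mdegree u = mdegree v \<and> Poly_Mapping.lookup u V1 < Poly_Mapping.lookup v V1"
  using oriented by (fastforce simp: rewrites_to_def mdegree_add lookup_add)

lemma lookup_le_weight: "Poly_Mapping.lookup u i \<le> weight n u"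
proof -
  have "Poly_Mapping.lookup u i \<le> mdegree u"
    unfolding mdegree_def by (rule member_le_sum) auto
  then show ?thesis using mdegree_le_weight[of n u] n_pos by simp
qed

text \<open>Rewriting need not decrease any global size of an exponent vector; it terminates because
  a weight class is finite.\<close>

definition potential :: "(idx \<Rightarrow>\<^sub>0 nat) \<Rightarrow> nat" where
  "potential u = (weight n u - mdegree u) * Suc (weight n u) + (weight n u - Poly_Mapping.lookup u V1)"

lemma rewrites_potential:
  assumes "rewrites_to R u v"
  shows "potential v < potential u"
proof -
  have w: "weight n v = weight n u" using rewrites_weight[OF assms] by simp
  have dv: "mdegree v \<le> weight n u" using mdegree_le_weight[of n v] n_pos w by simp
  have xv: "Poly_Mapping.lookup v V1 \<le> weight n u" using lookup_le_weight[of v V1] w by simp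
  from rewrites_oriented[OF assms] show ?thesis
  proof
    assume "mdegree u < mdegree v"
    then show ?thesis
      using dv unfolding potential_def w by (intro mult_Suc_add_less) auto
  qed (use xv in \<open>auto simp: potential_def w\<close>)
qed

lemma rewrites_locally_confluent:
  assumes "rewrites_to R u v" "rewrites_to R u v'"
  shows "joinable R v v'"
proof -
  obtain l t w where 1: "(l, t) \<in> R" "u = w + l" "v = w + t"
    using assms(1) unfolding rewrites_to_def by blast
  obtain l' t' w' where 2: "(l', t') \<in> R" "u = w' + l'" "v' = w' + t'"
    using assms(2) unfolding rewrites_to_def by blast
  obtain c where c: "w = c + (l' - l)" "w' = c + (l - l')"
    using add_eq_add_exponent[of w l w' l'] 1 2 by metis
  obtain z where "(rewrites_to R)\<^sup>*\<^sup>* ((l' - l) + t) z" "(rewrites_to R)\<^sup>*\<^sup>* ((l - l') + t') z"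
    using critical_pairs[OF 1(1) 2(1)] unfolding joinable_def by blast
  from rewrites_star_add[OF this(1), of c] rewrites_star_add[OF this(2), of c]
  show ?thesis using 1 2 c by (auto simp: joinable_def add.assoc)
qed

lemma ex_normal: "\<exists>w. normal w \<and> (rewrites_to R)\<^sup>*\<^sup>* u w"
proof (induction u rule: measure_induct_rule[of potential])
  case (less u)
  show ?case
  proof (cases "normal u")
    case False
    then obtain v where v: "rewrites_to R u v" by (auto simp: normal_def)
    then show ?thesis
      using less[OF rewrites_potential] by (meson converse_rtranclp_into_rtranclp)
  qed auto
qed

lemma rewrites_star_potential: "(rewrites_to R)\<^sup>*\<^sup>* u v \<Longrightarrow> potential v \<le> potential u"
  by (induction rule: rtranclp_induct) (auto dest: rewrites_potential)

text \<open>Newman's lemma for a fixed normal \<open>w\<close>, by induction on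
  \<open>potential\<close>: the given step to \<open>v\<close> and the first step \<open>y\<close>
  of a path to \<open>w\<close> join in some \<open>z\<close>, and \<open>z\<close> still reaches
  \<open>w\<close> because \<open>y\<close> does.\<close>

lemma rewrites_confluent:
  assumes "normal w" "rewrites_to R u v" "(rewrites_to R)\<^sup>*\<^sup>* u w"
  shows "(rewrites_to R)\<^sup>*\<^sup>* v w"
  using assms(2,3)
proof (induction u arbitrary: v rule: measure_induct_rule[of potential])
  case (less u)
  \<comment> \<open>The induction hypothesis extends from single steps to rewriting sequences, since
    these stay below the potential of \<open>u\<close>.\<close>
  have along: "(rewrites_to R)\<^sup>*\<^sup>* z w"
    if "(rewrites_to R)\<^sup>*\<^sup>* y z" "(rewrites_to R)\<^sup>*\<^sup>* y w" "potential y < potential u" for y z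
    using that
  proof (induction rule: rtranclp_induct)
    case (step z z')
    have "potential z < potential u"
      using rewrites_star_potential[OF step.hyps(1)] step.prems by simp
    then show ?case using less.IH step by blast
  qed
  have "u \<noteq> w" using assms(1) less.prems(1) by (auto simp: normal_def)
  then obtain y where y: "rewrites_to R u y" "(rewrites_to R)\<^sup>*\<^sup>* y w"
    using less.prems(2) by (auto elim: converse_rtranclpE)
  obtain z where z: "(rewrites_to R)\<^sup>*\<^sup>* y z" "(rewrites_to R)\<^sup>*\<^sup>* v z"
    using rewrites_locally_confluent[OF y(1) less.prems(1)] unfolding joinable_def by blast
  have "(rewrites_to R)\<^sup>*\<^sup>* z w" using along z(1) y rewrites_potential by blast
  then show ?case using z(2) by auto
qed

definition nf :: "(idx \<Rightarrow>\<^sub>0 nat) \<Rightarrow> (idx \<Rightarrow>\<^sub>0 nat)" where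
  "nf u = (SOME w. normal w \<and> (rewrites_to R)\<^sup>*\<^sup>* u w)"

lemma nf: "normal (nf u)" "(rewrites_to R)\<^sup>*\<^sup>* u (nf u)"
  using someI_ex[OF ex_normal, of u] by (auto simp: nf_def)

lemma normal_rewrites_star: "normal u \<Longrightarrow> (rewrites_to R)\<^sup>*\<^sup>* u w \<Longrightarrow> w = u"
  by (auto simp: normal_def elim: converse_rtranclpE)

lemma rewrites_star_weight: "(rewrites_to R)\<^sup>*\<^sup>* u v \<Longrightarrow> weight n u = weight n v"
  by (induction rule: rtranclp_induct) (auto dest: rewrites_weight)

lemma rewrites_star_mdegree: "(rewrites_to R)\<^sup>*\<^sup>* u v \<Longrightarrow> mdegree u \<le> mdegree v"
  by (induction rule: rtranclp_induct) (auto dest: rewrites_oriented)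

end

section \<open>Leading forms of the rules and the initial ideal\<close>

locale monomial_curve_standard_basis = monomial_curve_rewriting +
  fixes I :: "'k::field mpoly4 set"
  assumes I_curve: "I = curve_ideal n"
    and I_generated: "I \<subseteq> idl {pmon l - pmon t | l t. (l, t) \<in> R}"
begin

text \<open>By confluence the monomials rewriting to a fixed normal monomial are a union of classes of
  the congruence generated by the rules, so the functional summing the coefficients over them
  vanishes on \<open>I\<close>.\<close>

lemma normal_weight_unique:
  assumes "normal u" "normal v" "weight n u = weight n v"
  shows "u = v"
proof -
  let ?A = "{m. (rewrites_to R)\<^sup>*\<^sup>* m u}"
  have "(pmon u - pmon v :: 'k mpoly4) \<in> idl {pmon l - pmon t | l t. (l, t) \<in> R}"
    using I_generated assms(3) by (auto simp: I_curve binomial_mem_curve_ideal_iff)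
  then have "coeff_sum ?A (pmon u - pmon v :: 'k mpoly4) = 0"
  proof (rule coeff_sum_idl[rotated])
    fix g :: "'k mpoly4" and w
    assume "g \<in> {pmon l - pmon t | l t. (l, t) \<in> R}"
    then obtain l t where lt: "(l, t) \<in> R" and g: "g = pmon l - pmon t" by blast
    have "rewrites_to R (w + l) (w + t)" using lt by (auto simp: rewrites_to_def)
    then have "w + l \<in> ?A \<longleftrightarrow> w + t \<in> ?A"
      using rewrites_confluent[OF assms(1)] by (auto intro: converse_rtranclp_into_rtranclp)
    then show "coeff_sum ?A (pmon w * g) = 0"
      by (simp add: g right_diff_distrib mult_single coeff_sum_diff)
  qed
  then have "(rewrites_to R)\<^sup>*\<^sup>* v u" by (auto simp: coeff_sum_diff split: if_splits)
  then show ?thesis using normal_rewrites_star[OF assms(2)] by simp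
qed

lemma rewrites_lead_form:
  assumes "rewrites_to R u v"
  defines "J \<equiv> idl (lead_form ` R :: 'k mpoly4 set)"
  shows "if mdegree u < mdegree v then pmon u \<in> J
         else pmon u - pmon v \<in> J"
proof -
  obtain l t w where 1: "(l, t) \<in> R" "u = w + l" "v = w + t"
    using assms unfolding rewrites_to_def by blast
  have "pmon w * lead_form (l, t) \<in> J"
    unfolding J_def using 1(1) by (intro idl_mult idl_incl) auto
  then show ?thesis
    by (auto simp: 1 lead_form_def mdegree_add right_diff_distrib mult_single split: if_splits)
qed

text \<open>Along steps of constant degree the binomials telescope. Where the degree first rises,
  the monomial itself lies in the ideal, and so do the monomials before it.\<close>

lemma rewrites_star_lead_form:
  assumes "(rewrites_to R)\<^sup>*\<^sup>* u v"
  defines "J \<equiv> idl (lead_form ` R :: 'k mpoly4 set)"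
  shows "if mdegree u < mdegree v then pmon u \<in> J
         else pmon u - pmon v \<in> J"
  using assms(1)
proof (induction rule: converse_rtranclp_induct)
  case (step u y)
  have le: "mdegree u \<le> mdegree y" "mdegree y \<le> mdegree v"
    using rewrites_oriented[OF step.hyps(1)] rewrites_star_mdegree[OF step.hyps(2)] by auto
  have a: "pmon u \<in> J" if "mdegree u < mdegree y"
    using rewrites_lead_form[OF step.hyps(1)] that by (simp add: J_def)
  have b: "pmon u - pmon y \<in> J" if "\<not> mdegree u < mdegree y"
    using rewrites_lead_form[OF step.hyps(1)] that by (simp add: J_def)
  consider "mdegree u < mdegree y" | "mdegree u = mdegree y" "mdegree y < mdegree v"
    | "mdegree u = mdegree y" "mdegree y = mdegree v" using le by linarith
  then show ?case
  proof cases
    case 1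
    then show ?thesis using a le by auto
  next
    case 2
    then have "pmon y \<in> J" using step.IH by simp
    with b 2 show ?thesis using idl_add[of "pmon u - pmon y"] by (fastforce simp: J_def)
  next
    case 3
    then have "pmon y - pmon v \<in> J" using step.IH by simp
    with b 3 show ?thesis using idl_add[of "pmon u - pmon y"] by (fastforce simp: J_def)
  qed
qed (simp add: idl_zero J_def)

text \<open>Modulo the leading forms, a monomial becomes its normal form if that has the same degree and
  vanishes otherwise. Summed over the lowest degree part of \<open>f \<in> I\<close>, these residues
  cancel: all monomials of \<open>f\<close> whose normal form \<open>w\<close> has the lowest degree lie in that
  lowest degree, and they are exactly those of the weight of \<open>w\<close>.\<close>

lemma initial_form_mem:
  assumes f: "f \<in> I" "f \<noteq> 0"
  shows "initial_form f \<in> idl (lead_form ` R)"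
proof -
  define d where "d = Min (mdegree ` Poly_Mapping.keys f)"
  have d: "d \<le> mdegree m" if "m \<in> Poly_Mapping.keys f" for m
    unfolding d_def using that by simp
  define S where "S = {m. m \<in> Poly_Mapping.keys f \<and> mdegree m = d}"
  have finS: "finite S" unfolding S_def by simp
  define res :: "(idx \<Rightarrow>\<^sub>0 nat) \<Rightarrow> 'k mpoly4" where
    "res u = (if mdegree u = mdegree (nf u) then pmon (nf u) else 0)" for u
  have res: "pmon u - res u \<in> idl (lead_form ` R)" for u
    using rewrites_star_lead_form[OF nf(2)[of u]] rewrites_star_mdegree[OF nf(2)[of u]]
    by (auto simp: res_def split: if_splits)
  have "(\<Sum>u\<in>S. Poly_Mapping.single 0 (Poly_Mapping.lookup f u) * (pmon u - res u)) \<in> idl (lead_form ` R)"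
    by (intro idl_sum idl_mult res)
  moreover have "(\<Sum>u\<in>S. Poly_Mapping.single 0 (Poly_Mapping.lookup f u) * res u) = 0"
  proof (rule poly_mapping_eqI)
    fix w
    have "Poly_Mapping.lookup (\<Sum>u\<in>S. Poly_Mapping.single 0 (Poly_Mapping.lookup f u) * res u) w
      = (\<Sum>u\<in>S. if mdegree u = mdegree (nf u) \<and> nf u = w then Poly_Mapping.lookup f u else 0)"
      unfolding lookup_sum
      by (rule sum.cong) (auto simp: res_def mult_single lookup_single when_def)
    also have "\<dots> = (\<Sum>u\<in>{u\<in>S. mdegree u = mdegree (nf u) \<and> nf u = w}. Poly_Mapping.lookup f u)"
      using finS by (simp add: sum.If_cases Int_def)
    also have "\<dots> = 0"
    proof (cases "normal w \<and> mdegree w = d")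
      case True
      have "{u\<in>S. mdegree u = mdegree (nf u) \<and> nf u = w}
          = Poly_Mapping.keys f \<inter> {m. weight n m = weight n w}"
      proof (intro equalityI subsetI)
        fix u assume "u \<in> Poly_Mapping.keys f \<inter> {m. weight n m = weight n w}"
        then have u: "u \<in> Poly_Mapping.keys f" "weight n u = weight n w" by auto
        have "nf u = w"
          using True rewrites_star_weight[OF nf(2)] u(2) by (intro normal_weight_unique nf) auto
        \<comment> \<open>The degree of \<open>u\<close> is at least \<open>d\<close> and at most
          that of its normal form \<open>w\<close>, which is \<open>d\<close>.\<close>
        moreover from this have "mdegree u = d"
          using d[OF u(1)] rewrites_star_mdegree[OF nf(2)[of u]] True by simp
        ultimately show "u \<in> {u\<in>S. mdegree u = mdegree (nf u) \<and> nf u = w}"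
          using True u by (simp add: S_def)
      qed (use rewrites_star_weight[OF nf(2)] in \<open>auto simp: S_def\<close>)
      then show ?thesis
        using f(1) by (simp add: I_curve mem_curve_ideal_iff flip: coeff_sum_def)
    next
      case False
      then have "{u\<in>S. mdegree u = mdegree (nf u) \<and> nf u = w} = {}"
        using nf(1) by (auto simp: S_def)
      then show ?thesis by (simp only: sum.empty)
    qed
    finally show "Poly_Mapping.lookup (\<Sum>u\<in>S. Poly_Mapping.single 0 (Poly_Mapping.lookup f u) * res u) w
      = Poly_Mapping.lookup 0 w" by simp
  qed
  moreover have "initial_form f = (\<Sum>u\<in>S. Poly_Mapping.single 0 (Poly_Mapping.lookup f u) * pmon u)"
    by (simp add: initial_form_def hom_component_def S_def d_def mult_single)
  ultimately show ?thesis
    by (simp add: right_diff_distrib sum_subtractf)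
qed

theorem initial_ideal_eq: "initial_ideal I = idl (lead_form ` R)"
proof
  show "initial_ideal I \<subseteq> idl (lead_form ` R)"
    unfolding initial_ideal_def by (rule idl_minimal) (auto intro: initial_form_mem)
  \<comment> \<open>The binomial of a rule lies in \<open>I\<close> because both sides have the same
    weight, and its initial form is the leading form.\<close>
  show "idl (lead_form ` R) \<subseteq> initial_ideal I"
    unfolding initial_ideal_def
  proof (rule idl_minimal)
    fix g :: "'k mpoly4" assume "g \<in> lead_form ` R"
    then obtain l t where lt: "(l, t) \<in> R" and g: "g = lead_form (l, t)" by auto
    have le: "mdegree l \<le> mdegree t" and ne: "l \<noteq> t" using oriented[OF lt] by auto
    have "g = initial_form (pmon l - pmon t)"
      by (simp add: g lead_form_def initial_form_binomial[OF ne le])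
    moreover have "(pmon l - pmon t :: 'k mpoly4) \<in> I"
      using homogeneous[OF lt] by (simp add: I_curve binomial_mem_curve_ideal_iff)
    moreover have "(pmon l - pmon t :: 'k mpoly4) \<noteq> 0"
      using ne by (auto dest: arg_cong[where f = Poly_Mapping.keys])
    ultimately show "g \<in> idl {initial_form f | f. f \<in> I \<and> f \<noteq> 0}"
      by (intro idl_incl) blast
  qed
qed

text \<open>The left-hand side of each rule is the certificate required by
  \<open>minimally_generated_byI\<close>.\<close>

lemma minimally_generated_initial_ideal:
  assumes R: "R = set rs"
    and no_V1: "\<And>l t. (l, t) \<in> R \<Longrightarrow> Poly_Mapping.lookup l V1 = 0"
    and antichain: "sorted_wrt (\<lambda>(l, t) (l', t'). \<not> mdivides l l' \<and> \<not> mdivides l' l) rs"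
  shows "minimally_generated_by (initial_ideal I) (map lead_form rs)"
proof (rule minimally_generated_byI)
  show "idl (set (map lead_form rs)) = initial_ideal I" by (simp add: initial_ideal_eq R)
next
  fix i assume "i < length (map lead_form rs)"
  then have i: "i < length rs" by simp
  obtain l t where lt: "rs ! i = (l, t)" by fastforce
  have ltR: "(l, t) \<in> R" using i lt R by (metis nth_mem)
  then have "l \<noteq> t" using oriented by blast
  then have "Poly_Mapping.lookup (map lead_form rs ! i :: 'k mpoly4) l \<noteq> 0"
    using i lt by (simp add: lead_form_def lookup_minus lookup_single)
  moreover have "\<not> mdivides v l"
    if j: "j < length (map lead_form rs)" "j \<noteq> i" 
      and v: "v \<in> Poly_Mapping.keys (map lead_form rs ! j :: 'k mpoly4)" for j v
  proof -
    obtain l' t' where lt': "rs ! j = (l', t')" by fastforce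
    have ltR': "(l', t') \<in> R" using j lt' R by (metis length_map nth_mem)
    have "\<not> mdivides l' l"
    proof (cases i j rule: linorder_cases)
      case less
      then show ?thesis using sorted_wrt_nth_less[OF antichain less] j(1) lt lt' by simp
    next
      case greater
      then show ?thesis using sorted_wrt_nth_less[OF antichain greater] i lt lt' by simp
    qed (use j(2) in simp)
    \<comment> \<open>A right-hand side survives in a leading form only when the degrees agree; the
      orientation then makes it contain \<open>x1\<close>, so it divides no left-hand side.\<close>
    moreover have "v = l' \<or> v = t' \<and> Poly_Mapping.lookup v V1 > 0"
      using v j lt' oriented[OF ltR']
      by (auto simp: lead_form_def in_keys_iff lookup_minus lookup_single when_def split: if_splits)
    ultimately show ?thesis using no_V1[OF ltR] by (auto intro: exI[of _ V1])
  qed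
  ultimately show "\<exists>m. Poly_Mapping.lookup (map lead_form rs ! i :: 'k mpoly4) m \<noteq> 0 \<and>
      (\<forall>j<length (map lead_form rs). j \<noteq> i \<longrightarrow>
        (\<forall>v\<in>Poly_Mapping.keys (map lead_form rs ! j :: 'k mpoly4). \<not> mdivides v m))"
    by blast
qed

end

section \<open>Monomials in four variables and the relations between the exponents\<close>

text \<open>Explicit exponents turn products, cofactors and divisibility into arithmetic on four
  naturals.\<close>

definition mon4 :: "nat \<Rightarrow> nat \<Rightarrow> nat \<Rightarrow> nat \<Rightarrow> (idx \<Rightarrow>\<^sub>0 nat)" where
  "mon4 p q r s = Poly_Mapping.single V1 p + Poly_Mapping.single V2 q
     + Poly_Mapping.single V3 r + Poly_Mapping.single V4 s"

lemma lookup_mon4 [simp]: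
  "Poly_Mapping.lookup (mon4 p q r s) V1 = p"
  "Poly_Mapping.lookup (mon4 p q r s) V2 = q"
  "Poly_Mapping.lookup (mon4 p q r s) V3 = r"
  "Poly_Mapping.lookup (mon4 p q r s) V4 = s"
  by (simp_all add: mon4_def lookup_add lookup_single)

lemma all_idx: "(\<forall>i. P i) \<longleftrightarrow> P V1 \<and> P V2 \<and> P V3 \<and> P V4"
  by (metis idx.exhaust)

lemma mon4_eq_iff [simp]:
  "mon4 p q r s = mon4 p' q' r' s' \<longleftrightarrow> p = p' \<and> q = q' \<and> r = r' \<and> s = s'"
  by (auto simp: poly_mapping_eq_iff fun_eq_iff all_idx)

lemma mon4_add: "mon4 p q r s + mon4 p' q' r' s' = mon4 (p + p') (q + q') (r + r') (s + s')"
  by (simp add: poly_mapping_eq_iff fun_eq_iff all_idx lookup_add)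

lemma mon4_diff: "mon4 p q r s - mon4 p' q' r' s' = mon4 (p - p') (q - q') (r - r') (s - s')"
  by (simp add: poly_mapping_eq_iff fun_eq_iff all_idx lookup_minus)

lemma mdegree_mon4: "mdegree (mon4 p q r s) = p + q + r + s"
  by (simp add: mdegree_def UNIV_idx)

lemma weight_mon4: "weight n (mon4 p q r s) = p * n V1 + q * n V2 + r * n V3 + s * n V4"
  by (simp add: weight_def UNIV_idx)

lemma mvar_power:
  "(X1 :: 'k::field mpoly4) ^ k = pmon (mon4 k 0 0 0)"
  "(X2 :: 'k mpoly4) ^ k = pmon (mon4 0 k 0 0)"
  "(X3 :: 'k mpoly4) ^ k = pmon (mon4 0 0 k 0)"
  "(X4 :: 'k mpoly4) ^ k = pmon (mon4 0 0 0 k)"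
proof -
  have "mvar i ^ k = (pmon (Poly_Mapping.single i k) :: 'k mpoly4)" for i
    by (induction k) (simp_all add: mvar_def mult_single flip: single_add)
  then show "(X1 :: 'k mpoly4) ^ k = pmon (mon4 k 0 0 0)"
    "(X2 :: 'k mpoly4) ^ k = pmon (mon4 0 k 0 0)"
    "(X3 :: 'k mpoly4) ^ k = pmon (mon4 0 0 k 0)"
    "(X4 :: 'k mpoly4) ^ k = pmon (mon4 0 0 0 k)"
    by (simp_all add: mon4_def)
qed

lemma pmon_mon4_mult:
  "pmon (mon4 p q r s) * pmon (mon4 p' q' r' s')
     = (pmon (mon4 (p + p') (q + q') (r + r') (s + s')) :: 'k::field mpoly4)"
  by (simp add: mult_single mon4_add)

lemmas X_power_simps = mvar_power pmon_mon4_mult add_0 add_0_right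

section \<open>Bresinsky's relations between the exponents\<close>

lemma weight_eq_of_generators:
  assumes gen: "curve_ideal n = idl {pmon l - pmon t :: 'k::field mpoly4 | l t. (l, t) \<in> P}"
    and "(l, t) \<in> P"
  shows "weight n l = weight n t"
proof -
  have "(pmon l - pmon t :: 'k mpoly4) \<in> curve_ideal n"
    unfolding gen by (rule idl_incl) (use assms(2) in blast)
  then show ?thesis by (simp add: binomial_mem_curve_ideal_iff)
qed

lemma binomial_ideal_divides:
  assumes gen: "curve_ideal n = idl {pmon l - pmon t :: 'k::field mpoly4 | l t. (l, t) \<in> P}"
    and uv: "weight n u = weight n v" "u \<noteq> v"
  shows "\<exists>(l, t)\<in>P. mdivides l u \<or> mdivides t u"
proof (rule ccontr)
  assume *: "\<not> ?thesis"
  have "(pmon u - pmon v :: 'k mpoly4) \<in> curve_ideal n"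
    using uv(1) by (simp add: binomial_mem_curve_ideal_iff)
  then have "Poly_Mapping.lookup (pmon u - pmon v :: 'k mpoly4) u = 0"
    unfolding gen
  proof (rule lookup_idl_eq_0[rotated])
    fix g :: "'k mpoly4" and w
    assume "g \<in> {pmon l - pmon t | l t. (l, t) \<in> P}" "w \<in> Poly_Mapping.keys g"
    then obtain l t where "(l, t) \<in> P" "w = l \<or> w = t"
      by (auto simp: in_keys_iff lookup_minus lookup_single when_def split: if_splits)
    then show "\<not> mdivides w u" using * by blast
  qed
  then show False using uv(2) by (simp add: lookup_minus lookup_single)
qed

text \<open>If \<open>a\<close> and \<open>a'\<close> differ, cancelling leaves a relation between a
  multiple of \<open>N\<close> and one of \<open>M\<close> whose positive coefficient
  \<open>b - b'\<close> or \<open>a - a'\<close> undercuts the minimal \<open>b\<close> or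
  \<open>a\<close>.\<close>

lemma eq_exponents_of_minimal:
  fixes a b a' b' N M :: nat
  assumes "a * N + b * M = a' * N + b' * M" "0 < N" "0 < M" "0 < a'" "0 < b'"
    and "\<And>c d. c * N = d * M \<Longrightarrow> 0 < c \<Longrightarrow> a \<le> c"
    and "\<And>c d. c * N = d * M \<Longrightarrow> 0 < d \<Longrightarrow> b \<le> d"
    and "0 < a" "0 < b"
  shows "a = a' \<and> b = b'"
proof (cases a a' rule: linorder_cases)
  case less
  then have eq: "(a' - a) * N + b' * M = b * M" using assms(1) by (simp add: diff_mult_distrib)
  have "(a' - a) * N = (b - b') * M" by (simp add: diff_mult_distrib flip: eq)
  moreover have "0 < (a' - a) * N" using less assms(2) by simp
  ultimately have "b \<le> b - b'" using assms(7) by (metis nat_0_less_mult_iff)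
  then show ?thesis using assms(5,9) by simp
next
  case equal
  then show ?thesis using assms(1,3) by simp
next
  case greater
  then have eq: "(a - a') * N + b * M = b' * M" using assms(1) by (simp add: diff_mult_distrib)
  have "(a - a') * N = (b' - b) * M" by (simp add: diff_mult_distrib flip: eq)
  then have "a \<le> a - a'" using greater by (intro assms(6)) auto
  then show ?thesis using assms(4,8) by simp
qed

lemma bresinsky_relations:
  fixes n :: "idx \<Rightarrow> nat"
  assumes gen: "curve_ideal n = idl {pmon l - pmon t :: 'k::field mpoly4 | l t. (l, t) \<in>
      {(mon4 a1 0 0 0, mon4 0 a12 a13 0), (mon4 0 a2 0 0, mon4 a21 0 0 a24),
       (mon4 0 0 a3 0, mon4 0 a32 0 a34), (mon4 0 0 0 a4, mon4 a41 0 a43 0),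
       (mon4 a41 a32 0 0, mon4 0 0 a13 a24)}}" (is "_ = idl {_ | l t. _ \<in> ?P}")
    and n_pos: "\<And>i. 0 < n i"
    and pos: "0 < a1" "0 < a2" "0 < a3" "0 < a4" "0 < a12" "0 < a13" "0 < a21" "0 < a24"
      "0 < a32" "0 < a34" "0 < a41" "0 < a43"
  shows "a1 = a21 + a41" "a2 = a12 + a32" "a3 = a13 + a43" "a4 = a24 + a34"
proof -
  have w: "\<forall>(l, t)\<in>?P. weight n l = weight n t"
    using weight_eq_of_generators[OF gen] by blast
  have eqs: "a1 * n V1 = a12 * n V2 + a13 * n V3" "a2 * n V2 = a21 * n V1 + a24 * n V4"
    "a3 * n V3 = a32 * n V2 + a34 * n V4" "a4 * n V4 = a41 * n V1 + a43 * n V3"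
    "a41 * n V1 + a32 * n V2 = a13 * n V3 + a24 * n V4"
    using w by (simp_all add: weight_mon4)
  have div: "\<exists>(l, t)\<in>?P. mdivides l u \<or> mdivides t u" if "weight n u = weight n v" "u \<noteq> v" for u v
    using binomial_ideal_divides[OF gen that] .
  \<comment> \<open>Among the monomials of the generators only \<open>x1^a1\<close> is a pure power
    of \<open>x1\<close>, so it must divide \<open>x1^c\<close>. The other three bounds arise in the
    same way.\<close>
  have 1: "a1 \<le> c" if "c * n V1 = d * n V2" "0 < c" for c d
    using div[of "mon4 c 0 0 0" "mon4 0 d 0 0"] that pos
    by (auto simp: weight_mon4 all_idx)
  have 2: "a2 \<le> d" if "c * n V1 = d * n V2" "0 < d" for c d
    using div[of "mon4 0 d 0 0" "mon4 c 0 0 0"] that pos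
    by (auto simp: weight_mon4 all_idx)
  have 3: "a3 \<le> c" if "c * n V3 = d * n V4" "0 < c" for c d
    using div[of "mon4 0 0 c 0" "mon4 0 0 0 d"] that pos
    by (auto simp: weight_mon4 all_idx)
  have 4: "a4 \<le> d" if "c * n V3 = d * n V4" "0 < d" for c d
    using div[of "mon4 0 0 0 d" "mon4 0 0 c 0"] that pos
    by (auto simp: weight_mon4 all_idx)
  \<comment> \<open>Add the weight equations of \<open>f1\<close> and \<open>f2\<close> and
    eliminate \<open>n V3\<close> and \<open>n V4\<close> by that of \<open>f5\<close>; below,
    \<open>f3\<close> and \<open>f4\<close> are combined with \<open>f5\<close> likewise.\<close>
  have "a1 * n V1 + a2 * n V2 = (a21 + a41) * n V1 + (a12 + a32) * n V2"
    using eqs by (simp add: algebra_simps)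
  then have "a1 = a21 + a41 \<and> a2 = a12 + a32"
    by (rule eq_exponents_of_minimal) (use pos n_pos 1 2 in auto)
  then show "a1 = a21 + a41" "a2 = a12 + a32" by auto
  have "a3 * n V3 + a4 * n V4 = (a13 + a43) * n V3 + (a24 + a34) * n V4"
    using eqs by (simp add: algebra_simps)
  then have "a3 = a13 + a43 \<and> a4 = a24 + a34"
    by (rule eq_exponents_of_minimal) (use pos n_pos 3 4 in auto)
  then show "a3 = a13 + a43" "a4 = a24 + a34" by auto
qed

section \<open>Joining explicit critical pairs\<close>

lemma rewrites_mon4:
  assumes "(mon4 l1 l2 l3 l4, mon4 t1 t2 t3 t4) \<in> R" "l1 \<le> p" "l2 \<le> q" "l3 \<le> r" "l4 \<le> s"
  shows "rewrites_to R (mon4 p q r s) (mon4 (p - l1 + t1) (q - l2 + t2) (r - l3 + t3) (s - l4 + t4))"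
  unfolding rewrites_to_def
  by (rule exI[of _ "mon4 l1 l2 l3 l4"], rule exI[of _ "mon4 t1 t2 t3 t4"],
      rule exI[of _ "mon4 (p - l1) (q - l2) (r - l3) (s - l4)"])
    (use assms in \<open>simp add: mon4_add\<close>)

lemma joinable_left: "rewrites_to R u u' \<Longrightarrow> joinable R u' v \<Longrightarrow> joinable R u v"
  unfolding joinable_def by (meson converse_rtranclp_into_rtranclp)

lemma joinable_right: "rewrites_to R v v' \<Longrightarrow> joinable R u v' \<Longrightarrow> joinable R u v"
  unfolding joinable_def by (meson converse_rtranclp_into_rtranclp)

lemma joinable_refl [simp]: "joinable R u u"
  unfolding joinable_def by blast

lemma joinable_sym: "joinable R u v \<Longrightarrow> joinable R v u"
  unfolding joinable_def by blast

text \<open>Joinability is symmetric and a rule overlaps trivially with itself, which leaves one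
  pair for each two positions in the list.\<close>

lemma critical_pairs_listI:
  assumes "R = set rs"
    and "sorted_wrt (\<lambda>(l, t) (l', t'). joinable R ((l' - l) + t) ((l - l') + t')) rs"
    and "(l, t) \<in> R" "(l', t') \<in> R"
  shows "joinable R ((l' - l) + t) ((l - l') + t')"
proof -
  obtain i j where i: "i < length rs" "rs ! i = (l, t)" and j: "j < length rs" "rs ! j = (l', t')"
    using assms(1,3,4) by (auto simp: in_set_conv_nth)
  show ?thesis
  proof (cases i j rule: linorder_cases)
    case less
    then show ?thesis using sorted_wrt_nth_less[OF assms(2) less] i(2) j by simp
  next
    case equal
    then show ?thesis using i(2) j(2) by simp
  next
    case greater
    then show ?thesis using sorted_wrt_nth_less[OF assms(2) greater] i j(2) by (simp add: joinable_sym)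
  qed
qed

section \<open>Critical pairs\<close>

text \<open>The rules come from \<open>f1, \<dots>, f6\<close>, with \<open>a1, \<dots>, a4\<close> expressed by
  Bresinsky's relations; the left-hand sides are the leading monomials of the standard basis.\<close>

definition curve_rules :: "nat \<Rightarrow> nat \<Rightarrow> nat \<Rightarrow> nat \<Rightarrow> nat \<Rightarrow> nat \<Rightarrow> nat \<Rightarrow> nat \<Rightarrow>
    (idx \<Rightarrow>\<^sub>0 nat) \<Rightarrow> ((idx \<Rightarrow>\<^sub>0 nat) \<times> (idx \<Rightarrow>\<^sub>0 nat)) list" where
  "curve_rules a12 a13 a21 a24 a32 a34 a41 a43 t6 =
     [(mon4 0 a12 a13 0, mon4 (a21 + a41) 0 0 0),
      (mon4 0 (a12 + a32) 0 0, mon4 a21 0 0 a24),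
      (mon4 0 a32 0 a34, mon4 0 0 (a13 + a43) 0),
      (mon4 0 0 0 (a24 + a34), mon4 a41 0 a43 0),
      (mon4 0 0 a13 a24, mon4 a41 a32 0 0),
      (mon4 0 0 (a13 + a43 + a13) 0, t6)]"

text \<open>The third rule turns \<open>x2^a32 x3^a13 x4^a34\<close> into the left-hand side of the
  sixth; the fifth rule in the first case, the first rule in the second, turns it into
  \<open>t6\<close>.\<close>

lemma curve_rules_critical_pairs:
  fixes a12 a13 a21 a24 a32 a34 a41 a43 :: nat
  assumes le: "a24 \<le> a34"
    and tail: "a32 < a12 \<and> t6 = mon4 a41 (2 * a32) 0 (a34 - a24) \<or>
      a12 \<le> a32 \<and> t6 = mon4 (a21 + a41) (a32 - a12) 0 a34"
  defines "rs \<equiv> curve_rules a12 a13 a21 a24 a32 a34 a41 a43 t6"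
  shows "sorted_wrt (\<lambda>(l, t) (l', t'). joinable (set rs) ((l' - l) + t) ((l - l') + t')) rs"
proof -
  obtain e where e: "a34 = a24 + e" using le le_Suc_ex by blast
  obtain b1 b2 b4 where t6: "t6 = mon4 b1 b2 0 b4" using tail by blast
  define S where "S = set rs"
  have r1: "(mon4 0 a12 a13 0, mon4 (a21 + a41) 0 0 0) \<in> S"
    and r2: "(mon4 0 (a12 + a32) 0 0, mon4 a21 0 0 a24) \<in> S"
    and r3: "(mon4 0 a32 0 a34, mon4 0 0 (a13 + a43) 0) \<in> S"
    and r4: "(mon4 0 0 0 (a24 + a34), mon4 a41 0 a43 0) \<in> S"
    and r5: "(mon4 0 0 a13 a24, mon4 a41 a32 0 0) \<in> S"
    and r6: "(mon4 0 0 (a13 + a43 + a13) 0, mon4 b1 b2 0 b4) \<in> S"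
    by (simp_all add: S_def rs_def curve_rules_def t6)
  note L = joinable_left[OF rewrites_mon4] and R = joinable_right[OF rewrites_mon4]
  \<comment> \<open>With \<open>e\<close> and \<open>f\<close> the truncated differences in the
    exponents become sums, so that outcomes can be compared by associativity and
    commutativity.\<close>
  consider (less) f where "a12 = a32 + f" "b1 = a41" "b2 = 2 * a32" "b4 = e"
    | (ge) f where "a32 = a12 + f" "b1 = a21 + a41" "b2 = f" "b4 = a34"
    using tail t6 e by (fastforce dest: less_imp_add_positive le_Suc_ex)
  note t6_cases = this and ac = add.assoc add.commute add.left_commute
  show ?thesis
    unfolding S_def[symmetric]
    unfolding rs_def curve_rules_def t6
    apply (simp only: sorted_wrt.simps list.set ball_simps case_prod_conv mon4_add mon4_diff)
    apply (intro conjI TrueI)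
    \<comment> \<open>The fifteen pairs come in the order (1,2), ..., (1,6), (2,3), ..., (5,6).
      \<open>L\<close> rewrites the left outcome, \<open>R\<close> the right one; for coprime
      left-hand sides each outcome is rewritten by the other rule.\<close>
    subgoal by (rule R[OF r5], simp_all add: e ac mult_2)
    subgoal
      apply (rule t6_cases)
      subgoal by (rule R[OF r6], simp_all add: e ac mult_2, rule R[OF r2], simp_all add: e ac mult_2)
      subgoal by (rule R[OF r6], simp_all add: e ac mult_2)
      done
    subgoal by (rule L[OF r4], simp_all add: e ac mult_2, rule R[OF r1], simp_all add: e ac mult_2)
    subgoal by (rule R[OF r2], simp_all add: e ac mult_2)
    subgoal
      apply (rule t6_cases)
      subgoal by (rule R[OF r2], simp_all add: e ac mult_2, rule R[OF r3], simp_all add: e ac mult_2)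
      subgoal by (rule R[OF r3], simp_all add: e ac mult_2)
      done
    subgoal by (rule L[OF r4], simp_all add: e ac mult_2, rule R[OF r1], simp_all add: e ac mult_2)
    subgoal by (rule L[OF r4], simp_all add: e ac mult_2, rule R[OF r2], simp_all add: e ac mult_2)
    subgoal by (rule L[OF r5], simp_all add: e ac mult_2, rule R[OF r2], simp_all add: e ac mult_2)
    subgoal by (rule L[OF r6], simp_all add: e ac mult_2, rule R[OF r2], simp_all add: e ac mult_2)
    subgoal by (rule L[OF r5], simp_all add: e ac mult_2)
    subgoal
      apply (rule t6_cases)
      subgoal by (rule L[OF r6], simp_all add: e ac mult_2)
      subgoal by (rule L[OF r6], simp_all add: e ac mult_2, rule R[OF r2], simp_all add: e ac mult_2)
      done
    subgoal by (rule L[OF r6], simp_all add: e ac mult_2, rule R[OF r3], simp_all add: e ac mult_2)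
    subgoal by (rule R[OF r3], simp_all add: e ac mult_2)
    subgoal by (rule L[OF r6], simp_all add: e ac mult_2, rule R[OF r4], simp_all add: e ac mult_2)
    subgoal
      apply (rule t6_cases)
      subgoal by (rule R[OF r3], simp_all add: e ac mult_2)
      subgoal by (rule L[OF r1], simp_all add: e ac mult_2, rule R[OF r4], simp_all add: e ac mult_2)
      done
    done
qed

section \<open>The tangent cone\<close>

text \<open>At equal weight, lighter variables need a larger degree. This serves \<open>f1\<close>,
  the dual version below \<open>f4\<close>.\<close>

lemma less_of_weighted_eq:
  fixes a b c N M L :: nat
  assumes "a * N = b * M + c * L" "N < M" "N < L" "0 < b"
  shows "b + c < a"
proof -
  have "(b + c) * N < b * M + c * L"
    using assms(2-4) by (simp add: add_mult_distrib add_less_le_mono)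
  then have "(b + c) * N < a * N" using assms(1) by simp
  then show ?thesis by simp
qed

lemma greater_of_weighted_eq:
  fixes a b c N M L :: nat
  assumes "a * N = b * M + c * L" "M < N" "L < N" "0 < b"
  shows "a < b + c"
proof -
  have "b * M + c * L < (b + c) * N"
    using assms(2-4) by (simp add: add_mult_distrib add_less_le_mono)
  then have "a * N < (b + c) * N" using assms(1) by simp
  then show ?thesis by simp
qed

text \<open>\<open>N2\<close> separates the two sides: no weight on the left exceeds it, and those
  on the right are larger. This serves \<open>f5\<close>.\<close>

lemma less_of_weighted_eq2:
  fixes a b c d N1 N2 N3 N4 :: nat
  assumes "a * N1 + b * N2 = c * N3 + d * N4" "N1 < N2" "N2 < N3" "N3 < N4" "0 < a"
  shows "c + d < a + b"
proof -
  have "(c + d) * N2 \<le> c * N3 + d * N4"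
    using assms(3,4) by (simp add: add_mult_distrib add_mono)
  also have "\<dots> < (a + b) * N2"
    using assms(1,2,5) by (simp add: add_mult_distrib flip: assms(1))
  finally show ?thesis by simp
qed

text \<open>The bounds in \<open>deg\<close> orient the six rules. Where equality is allowed, for
  \<open>f2\<close> and \<open>f6\<close>, the power of \<open>x1\<close> on the right-hand side
  breaks the tie.\<close>

lemma initial_ideal_minimally_generated:
  fixes n :: "idx \<Rightarrow> nat" and I :: "'k::field mpoly4 set"
  assumes I: "I = curve_ideal n"
    and gen: "I = idl {pmon l - pmon t | l t. (l, t) \<in>
      {(mon4 (a21 + a41) 0 0 0, mon4 0 a12 a13 0), (mon4 0 (a12 + a32) 0 0, mon4 a21 0 0 a24),
       (mon4 0 0 (a13 + a43) 0, mon4 0 a32 0 a34), (mon4 0 0 0 (a24 + a34), mon4 a41 0 a43 0),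
       (mon4 a41 a32 0 0, mon4 0 0 a13 a24)}}" (is "_ = idl {_ | l t. _ \<in> ?P}")
    and n_pos: "\<And>i. 0 < n i"
    and pos: "0 < a12" "0 < a13" "0 < a21" "0 < a24" "0 < a32" "0 < a34" "0 < a41" "0 < a43"
    and deg: "a12 + a13 < a21 + a41" "a12 + a32 \<le> a21 + a24" "a32 + a34 < a13 + a43"
      "a24 + a34 < a41 + a43" "a13 + a24 < a41 + a32" "a13 + a43 + a13 \<le> mdegree t6"
    and le: "a24 \<le> a34"
    and tail: "a32 < a12 \<and> t6 = mon4 a41 (2 * a32) 0 (a34 - a24) \<or>
      a12 \<le> a32 \<and> t6 = mon4 (a21 + a41) (a32 - a12) 0 a34"
  shows "minimally_generated_by (initial_ideal I)
    (map lead_form (curve_rules a12 a13 a21 a24 a32 a34 a41 a43 t6))"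
proof -
  let ?rs = "curve_rules a12 a13 a21 a24 a32 a34 a41 a43 t6"
  have "\<forall>(l, t)\<in>?P. weight n l = weight n t"
    using weight_eq_of_generators[OF gen[unfolded I]] by blast
  then have eqs: "(a21 + a41) * n V1 = a12 * n V2 + a13 * n V3"
    "(a12 + a32) * n V2 = a21 * n V1 + a24 * n V4"
    "(a13 + a43) * n V3 = a32 * n V2 + a34 * n V4"
    "(a24 + a34) * n V4 = a41 * n V1 + a43 * n V3"
    "a41 * n V1 + a32 * n V2 = a13 * n V3 + a24 * n V4"
    by (simp_all add: weight_mon4)
  \<comment> \<open>The weight equation of \<open>f6\<close> combines those of \<open>f3\<close> and
    \<open>f5\<close> in the first case, and those of \<open>f1\<close> and \<open>f3\<close> in the
    second.\<close>
  have t6_weight: "(a13 + a43 + a13) * n V3 = weight n t6"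
    using tail
  proof (elim disjE conjE)
    assume t6: "t6 = mon4 a41 (2 * a32) 0 (a34 - a24)"
    obtain e where "a34 = a24 + e" using le le_Suc_ex by blast
    then show ?thesis using eqs(3,5) by (simp add: t6 weight_mon4 algebra_simps)
  next
    assume t6: "t6 = mon4 (a21 + a41) (a32 - a12) 0 a34" and "a12 \<le> a32"
    then obtain f where "a32 = a12 + f" using le_Suc_ex by blast
    then show ?thesis using eqs(1,3) by (simp add: t6 weight_mon4 algebra_simps)
  qed
  have t6_V1: "0 < Poly_Mapping.lookup t6 V1" using tail pos by auto
  interpret monomial_curve_standard_basis n "set ?rs" I
  proof
    fix l t assume lt: "(l, t) \<in> set ?rs"
    then show "weight n l = weight n t"
      using eqs t6_weight by (auto simp: curve_rules_def weight_mon4)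
    show "mdegree l < mdegree t \<or>
        mdegree l = mdegree t \<and> Poly_Mapping.lookup l V1 < Poly_Mapping.lookup t V1"
      using lt deg pos t6_V1 by (auto simp: curve_rules_def mdegree_mon4)
    fix l' t' assume "(l', t') \<in> set ?rs"
    then show "joinable (set ?rs) ((l' - l) + t) ((l - l') + t')"
      using critical_pairs_listI[OF refl curve_rules_critical_pairs[OF le tail] lt] by simp
  next
    show "I \<subseteq> idl {pmon l - pmon t | l t. (l, t) \<in> set ?rs}" (is "_ \<subseteq> ?J")
      unfolding gen
    proof (rule idl_minimal)
      have rule: "pmon l - pmon t \<in> ?J \<and> pmon t - pmon l \<in> ?J" if "(l, t) \<in> set ?rs" for l t
      proof -
        have "pmon l - pmon t \<in> ?J" using that by (intro idl_incl) blast
        then show ?thesis using idl_uminus by fastforce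
      qed
      fix g :: "'k mpoly4" assume "g \<in> {pmon l - pmon t | l t. (l, t) \<in> ?P}"
      then obtain l t where lt: "(l, t) \<in> ?P" "g = pmon l - pmon t" by blast
      \<comment> \<open>The rules reverse \<open>f1\<close>, \<open>f3\<close> and
        \<open>f5\<close>, so the generators are recovered up to sign.\<close>
      then have "(l, t) \<in> set ?rs \<or> (t, l) \<in> set ?rs" by (auto simp: curve_rules_def)
      then show "g \<in> ?J" using rule lt(2) by blast
    qed
  qed (fact n_pos I)+
  show ?thesis
  proof (rule minimally_generated_initial_ideal)
    show "Poly_Mapping.lookup l V1 = 0" if "(l, t) \<in> set ?rs" for l t
      using that by (auto simp: curve_rules_def)
    show "sorted_wrt (\<lambda>(l, t) (l', t'). \<not> mdivides l l' \<and> \<not> mdivides l' l) ?rs"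
      using pos by (auto simp: curve_rules_def all_idx)
  qed simp
qed

theorem theorem2p20:
  fixes n :: "idx \<Rightarrow> nat"
    and I :: "'k::field mpoly4 set"
    and a1 a2 a3 a4 a12 a13 a21 a24 a32 a34 a41 a43 :: nat
    and p2 :: "'k mpoly4"
  assumes n_order: "0 < n V1" "n V1 < n V2" "n V2 < n V3" "n V3 < n V4"
    and n_gcd: "Gcd (range n) = 1"
    and I_def: "I = curve_ideal n"
    and gorenstein: "curve_gorenstein n"
    and not_ci: "\<not> three_generated I"
    and tangent_cone_cm: "cohen_macaulay (mpoly4_ring Quot (initial_ideal I))"
    and I_gens: "minimally_generated_by I
        [X1 ^ a1 - X2 ^ a12 * X3 ^ a13,
         X2 ^ a2 - X1 ^ a21 * X4 ^ a24,
         X3 ^ a3 - X2 ^ a32 * X4 ^ a34,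
         X4 ^ a4 - X1 ^ a41 * X3 ^ a43,
         X1 ^ a41 * X2 ^ a32 - X3 ^ a13 * X4 ^ a24]"
    and a_gt_1: "a1 > 1" "a2 > 1" "a3 > 1" "a4 > 1"
    and a_bounds:
        "0 < a12" "a12 < a2" "0 < a13" "a13 < a3"
        "0 < a21" "a21 < a1" "0 < a24" "a24 < a4"
        "0 < a32" "a32 < a2" "0 < a34" "a34 < a4"
        "0 < a41" "a41 < a1" "0 < a43" "a43 < a3"
    and a3_gt: "a3 > a32 + a34"
    and a24_le: "a24 \<le> a34"
    and p2_lt: "a2 < a21 + a24 \<Longrightarrow> p2 = X2 ^ a2"
    and p2_eq: "a2 = a21 + a24 \<Longrightarrow> p2 = X2 ^ a2 - X1 ^ a21 * X4 ^ a24"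
  shows
    "(a32 < a12 \<longrightarrow>
        a2 \<le> a21 + a24 \<longrightarrow> a3 + a13 \<le> a41 + 2 * a32 + a34 - a24 \<longrightarrow>
        minimally_generated_by (initial_ideal I)
          [X2 ^ a12 * X3 ^ a13,
           p2,
           X2 ^ a32 * X4 ^ a34,
           X4 ^ a4,
           X3 ^ a13 * X4 ^ a24,
           if a3 + a13 < a41 + 2 * a32 + a34 - a24
             then X3 ^ (a3 + a13)
             else X3 ^ (a3 + a13) - X1 ^ a41 * X2 ^ (2 * a32) * X4 ^ (a34 - a24)]) \<and>
     (a12 \<le> a32 \<longrightarrow>
        a2 \<le> a21 + a24 \<longrightarrow> a3 + a13 \<le> a1 + (a32 - a12) + a34 \<longrightarrow>
        minimally_generated_by (initial_ideal I)
          [X2 ^ a12 * X3 ^ a13,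
           p2,
           X2 ^ a32 * X4 ^ a34,
           X4 ^ a4,
           X3 ^ a13 * X4 ^ a24,
           if a3 + a13 < a1 + (a32 - a12) + a34
             then X3 ^ (a3 + a13)
             else X3 ^ (a3 + a13) - X1 ^ a1 * X2 ^ (a32 - a12) * X4 ^ a34])"
proof -
  have n_pos: "0 < n i" for i using n_order by (cases i) auto
  have gen: "curve_ideal n = idl {pmon l - pmon t :: 'k mpoly4 | l t. (l, t) \<in>
      {(mon4 a1 0 0 0, mon4 0 a12 a13 0), (mon4 0 a2 0 0, mon4 a21 0 0 a24),
       (mon4 0 0 a3 0, mon4 0 a32 0 a34), (mon4 0 0 0 a4, mon4 a41 0 a43 0),
       (mon4 a41 a32 0 0, mon4 0 0 a13 a24)}}" (is "_ = idl {_ | l t. _ \<in> ?P}")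
  proof -
    have "{pmon l - pmon t :: 'k mpoly4 | l t. (l, t) \<in> ?P} = (\<lambda>(l, t). pmon l - pmon t) ` ?P"
      by (auto simp: image_iff)
    then show ?thesis
      using I_gens by (simp add: minimally_generated_by_def I_def X_power_simps)
  qed
  have pos: "0 < a1" "0 < a2" "0 < a3" "0 < a4" using a_gt_1 by auto
  note rel = bresinsky_relations[OF gen n_pos pos a_bounds(1,3,5,7,9,11,13,15)]
  have "\<forall>(l, t)\<in>?P. weight n l = weight n t"
    using weight_eq_of_generators[OF gen] by blast
  then have eqs: "a1 * n V1 = a12 * n V2 + a13 * n V3" "a4 * n V4 = a41 * n V1 + a43 * n V3"
    "a41 * n V1 + a32 * n V2 = a13 * n V3 + a24 * n V4"
    by (simp_all add: weight_mon4)
  \<comment> \<open>The order of the weights decides the degrees in \<open>f1\<close>,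
    \<open>f4\<close> and \<open>f5\<close>; for \<open>f2\<close>, \<open>f3\<close> and
    \<open>f6\<close> they are compared by hypothesis.\<close>
  have deg: "a12 + a13 < a1" "a4 < a41 + a43" "a13 + a24 < a41 + a32"
    using less_of_weighted_eq[OF eqs(1)] greater_of_weighted_eq[OF eqs(2)]
      less_of_weighted_eq2[OF eqs(3)] n_order a_bounds by auto
  \<comment> \<open>Among the first five rules only that of \<open>f2\<close> can preserve the
    degree, which is the distinction made by \<open>p2\<close>.\<close>
  have forms: "map lead_form (curve_rules a12 a13 a21 a24 a32 a34 a41 a43 t6) =
      [X2 ^ a12 * X3 ^ a13, p2, X2 ^ a32 * X4 ^ a34, X4 ^ a4, X3 ^ a13 * X4 ^ a24,
       lead_form (mon4 0 0 (a3 + a13) 0, t6)]" if "a2 \<le> a21 + a24" for t6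
    using that deg a3_gt p2_lt p2_eq
    by (cases "a2 = a21 + a24") (simp_all add: curve_rules_def lead_form_def mdegree_mon4 X_power_simps rel)
  have basis: "minimally_generated_by (initial_ideal I)
      [X2 ^ a12 * X3 ^ a13, p2, X2 ^ a32 * X4 ^ a34, X4 ^ a4, X3 ^ a13 * X4 ^ a24,
       lead_form (mon4 0 0 (a3 + a13) 0, t6)]"
    if "a2 \<le> a21 + a24" "a3 + a13 \<le> mdegree t6"
      "a32 < a12 \<and> t6 = mon4 a41 (2 * a32) 0 (a34 - a24) \<or>
       a12 \<le> a32 \<and> t6 = mon4 (a21 + a41) (a32 - a12) 0 a34" for t6
    unfolding forms[OF that(1), symmetric]
    by (rule initial_ideal_minimally_generated[OF I_def _ n_pos])
      (use gen that deg a_bounds a3_gt a24_le in \<open>simp_all add: I_def rel\<close>)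
  show ?thesis
  proof (intro conjI impI)
    assume h: "a32 < a12" "a2 \<le> a21 + a24" "a3 + a13 \<le> a41 + 2 * a32 + a34 - a24"
    then show "minimally_generated_by (initial_ideal I)
          [X2 ^ a12 * X3 ^ a13, p2, X2 ^ a32 * X4 ^ a34, X4 ^ a4, X3 ^ a13 * X4 ^ a24,
           if a3 + a13 < a41 + 2 * a32 + a34 - a24
             then X3 ^ (a3 + a13)
             else X3 ^ (a3 + a13) - X1 ^ a41 * X2 ^ (2 * a32) * X4 ^ (a34 - a24)]"
      \<comment> \<open>Since \<open>a24 \<le> a34\<close>, the degree of this monomial is the
        right-hand side of the bound in \<open>h\<close>.\<close>
      using basis[of "mon4 a41 (2 * a32) 0 (a34 - a24)"] a24_le
      by (cases "a3 + a13 < a41 + 2 * a32 + a34 - a24")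
        (simp_all add: lead_form_def mdegree_mon4 X_power_simps)
  next
    assume h: "a12 \<le> a32" "a2 \<le> a21 + a24" "a3 + a13 \<le> a1 + (a32 - a12) + a34"
    then show "minimally_generated_by (initial_ideal I)
          [X2 ^ a12 * X3 ^ a13, p2, X2 ^ a32 * X4 ^ a34, X4 ^ a4, X3 ^ a13 * X4 ^ a24,
           if a3 + a13 < a1 + (a32 - a12) + a34
             then X3 ^ (a3 + a13)
             else X3 ^ (a3 + a13) - X1 ^ a1 * X2 ^ (a32 - a12) * X4 ^ a34]"
      using basis[of "mon4 a1 (a32 - a12) 0 a34"]
      by (cases "a3 + a13 < a1 + (a32 - a12) + a34")
        (simp_all add: lead_form_def mdegree_mon4 X_power_simps rel)
  qed
qed

end
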